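(* Let $n\ge 2$, $m\ge 2$, $N=\{1,\dots,n\}$, and let $\mathcal{A}=(a_{i_1\cdots i_m})\in\mathbb{R}^{[m,n]}$ be a weakly symmetric nonnegative tensor. Then, with $\Omega_{max}(\mathcal{A})$ as defined in the context, $$\begin{aligned} \Omega_{max}(\mathcal{A})&\le\max_{i\in N}\min_{j\in N,\, j\neq i}\frac12\left\{r_i^{\overline{\Delta}_j}(\mathcal{A})+\sqrt{\big(r_i^{\overline{\Delta}_j}(\mathcal{A})\big)^2+4\,r_i^{\Delta_j}(\mathcal{A})R_j(\mathcal{A})}\right\}\\ &\le\max_{i\in N}\min_{j\in N,\, j\neq i}\frac12\left\{R_i(\mathcal{A})-a_{ij\cdots j}+\sqrt{\big(R_i(\mathcal{A})-a_{ij\cdots j}\big)^2+4\,a_{ij\cdots j}R_j(\mathcal{A})}\right\}\\ &\le\max_{i\in N}R_i(\mathcal{A}). \end{aligned}$$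
   Context: $\mathbb{R}^{[m,n]}$ denotes the set of real tensors of order $m$ and dimension $n$, i.e. arrays $\mathcal{A}=(a_{i_1i_2\cdots i_m})$ with $a_{i_1\cdots i_m}\in\mathbb{R}$ for all $i_1,\dots,i_m\in N=\{1,\dots,n\}$. $\mathcal{A}$ is nonnegative if all its entries are $\ge 0$. For a vector $x=(x_1,\dots,x_n)^T$, $\mathcal{A}x^{m-1}$ is the $n$-dimensional vector with $i$th component $(\mathcal{A}x^{m-1})_i=\sum_{i_2,\dots,i_m\in N}a_{ii_2\cdots i_m}x_{i_2}\cdots x_{i_m}$, and $\mathcal{A}x^m=\sum_{i_1,\dots,i_m\in N}a_{i_1\cdots i_m}x_{i_1}\cdots x_{i_m}$. $\mathcal{A}$ is weakly symmetric if the homogeneous polynomial $\mathcal{A}x^m$ satisfies $\nabla \mathcal{A}x^m=m\mathcal{A}x^{m-1}$. For $i,j\in N$, $$R_i(\mathcal{A})=\sum_{i_2,\dots,i_m\in N}|a_{ii_2\cdots i_m}|,\qquad r_i^{\Delta_j}(\mathcal{A})=\sum_{j\in\{i_2,\dots,i_m\}}|a_{ii_2\cdots i_m}|,\qquad r_i^{\overline{\Delta}_j}(\mathcal{A})=\sum_{j\notin\{i_2,\dots,i_m\}}|a_{ii_2\cdots i_m}|,$$ where the last two sums run over all tuples $(i_2,\dots,i_m)\in N^{m-1}$ such that $j$ does, respectively does not, occur among $i_2,\dots,i_m$ (in particular $r_j^{\Delta_j}$ and $r_j^{\overline{\Delta}_j}$ are these quantities with first index equal to $j$). The entry $a_{ij\cdots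 j}$ has first index $i$ and all other $m-1$ indices equal to $j$. Define $\Omega_{max}(\mathcal{A})=\max\big\{\hat{\Omega}_{max}(\mathcal{A}),\tilde{\Omega}_{max}(\mathcal{A})\big\}$, where $$\hat{\Omega}_{max}(\mathcal{A})=\max_{i\in N}\min_{j\in N,\, j\neq i}\min\big\{r_i^{\overline{\Delta}_j}(\mathcal{A}),\,r_j^{\Delta_j}(\mathcal{A})\big\},$$ $$\tilde{\Omega}_{max}(\mathcal{A})=\max_{i\in N}\min_{j\in N,\, j\neq i}\min\left\{R_i(\mathcal{A}),\,\bar{\Omega}_{i,j}(\mathcal{A})\right\},$$ $$\bar{\Omega}_{i,j}(\mathcal{A})=\frac12\left\{r_i^{\overline{\Delta}_j}(\mathcal{A})+r_j^{\Delta_j}(\mathcal{A})+\sqrt{\big(r_i^{\overline{\Delta}_j}(\mathcal{A})-r_j^{\Delta_j}(\mathcal{A})\big)^2+4\,r_i^{\Delta_j}(\mathcal{A})\,r_j^{\overline{\Delta}_j}(\mathcal{A})}\right\}.$$ *)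

theory Defs
  imports "HOL-Analysis.Analysis"
begin

(* A real tensor of order m and dimension n = CARD('n) is a function on index lists,
   of which only the values at lists of length m matter.  The order m cannot be recovered
   from such a function, so it is an explicit argument of everything below. *)
type_synonym 'n tensor = "'n list \<Rightarrow> real"

definition tuples :: "nat \<Rightarrow> 'n::finite list set" where
  "tuples k = {is. length is = k}"

lemma finite_tuples [simp]: "finite (tuples k :: 'n::finite list set)"
  using finite_lists_length_eq [of "UNIV :: 'n set" k] by (simp add: tuples_def)

definition nonneg_tensor :: "nat \<Rightarrow> 'n::finite tensor \<Rightarrow> bool" where
  "nonneg_tensor m A \<longleftrightarrow> (\<forall>is\<in>tuples m. A is \<ge> 0)"

(* the vector A x^(m-1) *)
definition tensor_apply :: "nat \<Rightarrow> 'n::finite tensor \<Rightarrow> real ^ 'n \<Rightarrow> real ^ 'n" where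
  "tensor_apply m A x = (\<chi> i. \<Sum>is\<in>tuples (m - 1). A (i # is) * (\<Prod>k\<leftarrow>is. x $ k))"

(* the homogeneous polynomial A x^m *)
definition tensor_form :: "nat \<Rightarrow> 'n::finite tensor \<Rightarrow> real ^ 'n \<Rightarrow> real" where
  "tensor_form m A x = (\<Sum>is\<in>tuples m. A is * (\<Prod>k\<leftarrow>is. x $ k))"

definition weakly_symmetric :: "nat \<Rightarrow> 'n::finite tensor \<Rightarrow> bool" where
  "weakly_symmetric m A \<longleftrightarrow>
     (\<forall>x. GDERIV (tensor_form m A) x :> real m *\<^sub>R tensor_apply m A x)"

definition row_sum :: "nat \<Rightarrow> 'n::finite tensor \<Rightarrow> 'n \<Rightarrow> real" where
  "row_sum m A i = (\<Sum>is\<in>tuples (m - 1). \<bar>A (i # is)\<bar>)"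

(* row_sum_with m A i j is r_i^(Delta_j), row_sum_without m A i j is r_i^(overline Delta_j):
   the first index i is not itself inspected for occurrences of j *)
definition row_sum_with :: "nat \<Rightarrow> 'n::finite tensor \<Rightarrow> 'n \<Rightarrow> 'n \<Rightarrow> real" where
  "row_sum_with m A i j = (\<Sum>is\<in>{is \<in> tuples (m - 1). j \<in> set is}. \<bar>A (i # is)\<bar>)"

definition row_sum_without :: "nat \<Rightarrow> 'n::finite tensor \<Rightarrow> 'n \<Rightarrow> 'n \<Rightarrow> real" where
  "row_sum_without m A i j = (\<Sum>is\<in>{is \<in> tuples (m - 1). j \<notin> set is}. \<bar>A (i # is)\<bar>)"

(* the entry a_{i j ... j} *)
definition off_entry :: "nat \<Rightarrow> 'n::finite tensor \<Rightarrow> 'n \<Rightarrow> 'n \<Rightarrow> real" where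
  "off_entry m A i j = A (i # replicate (m - 1) j)"

definition Omega_hat_max :: "nat \<Rightarrow> 'n::finite tensor \<Rightarrow> real" where
  "Omega_hat_max m A =
     (MAX i. MIN j\<in>UNIV - {i}. min (row_sum_without m A i j) (row_sum_with m A j j))"

definition Omega_bar :: "nat \<Rightarrow> 'n::finite tensor \<Rightarrow> 'n \<Rightarrow> 'n \<Rightarrow> real" where
  "Omega_bar m A i j =
     1 / 2 * (row_sum_without m A i j + row_sum_with m A j j
       + sqrt ((row_sum_without m A i j - row_sum_with m A j j)\<^sup>2
               + 4 * row_sum_with m A i j * row_sum_without m A j j))"

definition Omega_tilde_max :: "nat \<Rightarrow> 'n::finite tensor \<Rightarrow> real" where
  "Omega_tilde_max m A =
     (MAX i. MIN j\<in>UNIV - {i}. min (row_sum m A i) (Omega_bar m A i j))"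

definition Omega_max :: "nat \<Rightarrow> 'n::finite tensor \<Rightarrow> real" where
  "Omega_max m A = max (Omega_hat_max m A) (Omega_tilde_max m A)"

end

theory Submission
  imports Defs
begin

text \<open>
  Write \<open>d\<close> for the part of the row sum \<open>R\<^sub>i\<close> that involves \<open>j\<close>. For a pair \<open>(i, j)\<close>, the second and third bounds are both the
  larger root \<open>x\<close> of \<open>x (x - (R\<^sub>i - c)) = c R\<^sub>j\<close>, with \<open>c = d\<close> and \<open>c = a\<^sub>i\<^sub>j\<^sub>.\<^sub>.\<^sub>.\<^sub>j \<le> d\<close> respectively, and this root lies
  between \<open>R\<^sub>i\<close> and \<open>R\<^sub>j\<close>. The first inequality holds for each pair \<open>(i, j)\<close>. The second one does so only
  if \<open>R\<^sub>j \<le> R\<^sub>i\<close>, since the root decreases in \<open>c\<close> there and increases otherwise. This suffices unless \<open>R\<^sub>i\<close> is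
  the strict minimum of the row sums; in that case one compares with any other row \<open>k\<close>: the pair \<open>(k, i)\<close>
  of the third bound dominates the pair \<open>(i, k)\<close> of the second, and the pairs \<open>(k, j)\<close> with \<open>j \<noteq> i\<close> are at
  least the second smallest row sum.
\<close>

section \<open>Inequalities for the larger root of a quadratic\<close>

definition larger_root :: "real \<Rightarrow> real \<Rightarrow> real \<Rightarrow> real" where
  "larger_root p d r = 1 / 2 * (p + sqrt (p\<^sup>2 + 4 * d * r))"

text \<open>A quadratic with leading coefficient 1 is nonpositive only between its roots. With the
  next lemma, this turns bounds on the root into polynomial inequalities.\<close>

lemma le_larger_rootI:
  assumes "x * (x - p) \<le> d * r"
  shows "x \<le> larger_root p d r"
proof -
  have "(2 * x - p)\<^sup>2 \<le> p\<^sup>2 + 4 * d * r"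
    using assms by (simp add: power2_eq_square algebra_simps)
  then have "2 * x - p \<le> sqrt (p\<^sup>2 + 4 * d * r)"
    by (rule real_le_rsqrt)
  then show ?thesis by (simp add: larger_root_def)
qed

text \<open>The condition \<open>p <= 2 * x\<close> puts \<open>x\<close> to the right of the
  vertex, which excludes points left of the smaller root.\<close>

lemma larger_root_leI:
  assumes "d * r \<le> x * (x - p)" "p \<le> 2 * x"
  shows "larger_root p d r \<le> x"
proof -
  have "p\<^sup>2 + 4 * d * r \<le> (2 * x - p)\<^sup>2"
    using assms by (simp add: power2_eq_square algebra_simps)
  then have "sqrt (p\<^sup>2 + 4 * d * r) \<le> 2 * x - p"
    using assms by (intro real_le_lsqrt) auto
  then show ?thesis by (simp add: larger_root_def)
qed

lemma larger_root_eq: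
  assumes "0 \<le> d * r"
  shows "larger_root p d r * (larger_root p d r - p) = d * r"
proof -
  define s where "s = sqrt (p\<^sup>2 + 4 * d * r)"
  have "s * s = p\<^sup>2 + 4 * d * r"
    using assms by (simp add: s_def mult.assoc)
  then show ?thesis
    by (simp add: larger_root_def flip: s_def) (simp add: field_simps power2_eq_square)
qed

lemma larger_root_ge:
  assumes "0 \<le> d * r"
  shows "p \<le> larger_root p d r"
  using assms by (intro le_larger_rootI) simp

text \<open>For \<open>p = R - d\<close> the quadratic is \<open>x * (x - R) + d * (x - r)\<close>.
  Both terms are nonpositive at \<open>min R r\<close>; dually, they are nonnegative at
  \<open>max R r\<close> in the next lemma.\<close>

lemma min_le_larger_root:
  assumes "0 \<le> d" "0 \<le> R" "0 \<le> r"
  shows "min R r \<le> larger_root (R - d) d r"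
proof (rule le_larger_rootI)
  let ?x = "min R r"
  have "?x * (?x - R) \<le> 0" using assms by (intro mult_nonneg_nonpos) auto
  moreover have "d * ?x \<le> d * r" using assms by (intro mult_left_mono) auto
  ultimately show "?x * (?x - (R - d)) \<le> d * r" by (simp add: algebra_simps)
qed

lemma larger_root_le_max:
  assumes "0 \<le> d" "0 \<le> R"
  shows "larger_root (R - d) d r \<le> max R r"
proof (rule larger_root_leI)
  let ?x = "max R r"
  have "0 \<le> ?x * (?x - R)" using assms by (intro mult_nonneg_nonneg) auto
  moreover have "d * r \<le> d * ?x" using assms by (intro mult_left_mono) auto
  ultimately show "d * r \<le> ?x * (?x - (R - d))" by (simp add: algebra_simps)
qed (use assms in auto)

text \<open>At the root \<open>x\<close> for \<open>d\<close>, the quadratic for \<open>a\<close>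
  takes the value \<open>- (d - a) * (x - r)\<close>, and \<open>x >= min R r = r\<close>.\<close>

lemma larger_root_antimono:
  assumes "0 \<le> a" "a \<le> d" "0 \<le> r" "r \<le> R"
  shows "larger_root (R - d) d r \<le> larger_root (R - a) a r"
proof (rule le_larger_rootI)
  let ?x = "larger_root (R - d) d r"
  have "r \<le> ?x" using min_le_larger_root[of d R r] assms by simp
  then have "0 \<le> (d - a) * (?x - r)" using assms by simp
  moreover have "?x * (?x - (R - d)) = d * r"
    using assms by (intro larger_root_eq) simp
  ultimately show "?x * (?x - (R - a)) \<le> a * r" by (simp add: algebra_simps)
qed

text \<open>The claim amounts to \<open>a * (x - R) <= x * (r - x)\<close> for the left root
  \<open>x\<close>. Multiplied by \<open>x\<close>, its left side becomes
  \<open>a * d * (r - x)\<close> by the equation of \<open>x\<close>, and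
  \<open>a * d <= d * r <= x * x\<close>. Cancelling \<open>x\<close> again requires
  \<open>x\<close> to be nonzero.\<close>

lemma larger_root_swap:
  assumes "0 \<le> d" "d \<le> R" "0 \<le> a" "a \<le> r" "R < r"
  shows "larger_root (R - d) d r \<le> larger_root (r - a) a R"
proof (cases "larger_root (R - d) d r = 0")
  case True
  have "0 \<le> larger_root (r - a) a R"
    using assms larger_root_ge[of a R "r - a"] by simp
  with True show ?thesis by simp
next
  case False
  let ?x = "larger_root (R - d) d r"
  have ge: "R - d \<le> ?x" using assms by (intro larger_root_ge) simp
  with False assms have pos: "0 < ?x" by simp
  have le: "?x \<le> r" using larger_root_le_max[of d R r] assms by simp
  have eq: "?x * (?x - (R - d)) = d * r" using assms by (intro larger_root_eq) simp
  have "d * a \<le> d * r" using assms by (intro mult_left_mono) auto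
  also have "\<dots> \<le> d * r + ?x * (R - d)" using pos assms by simp
  also have "\<dots> = ?x * ?x" using eq by (simp add: algebra_simps)
  finally have "d * a * (r - ?x) \<le> ?x * ?x * (r - ?x)"
    using le by (intro mult_right_mono) auto
  moreover have "?x * (?x - R) = d * (r - ?x)"
    using eq by (simp add: algebra_simps)
  then have "d * a * (r - ?x) = ?x * (a * (?x - R))"
    by (simp add: mult_ac)
  ultimately have "?x * (a * (?x - R)) \<le> ?x * (?x * (r - ?x))"
    by (simp only: mult.assoc)
  then have "a * (?x - R) \<le> ?x * (r - ?x)"
    using pos by simp
  then show ?thesis
    by (intro le_larger_rootI) (simp add: algebra_simps)
qed

text \<open>Here \<open>w + d\<close> and \<open>s + t\<close> are the sums of rows \<open>i\<close>
  and \<open>j\<close>, each split by whether \<open>j\<close> occurs among the later indices. The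
  second term of the minimum is the larger root \<open>y\<close> of
  \<open>(y - s) * (y - w) = d * t\<close>; adding \<open>s * (y - w) <= s * d\<close> to this
  equation settles the case \<open>y <= w + d\<close>.\<close>

lemma min_le_larger_root_row_pair:
  fixes w d s t :: real
  assumes "0 \<le> w" "0 \<le> d" "0 \<le> s" "0 \<le> t"
  shows "min (w + d) (1 / 2 * (w + s + sqrt ((w - s)\<^sup>2 + 4 * d * t))) \<le> larger_root w d (s + t)"
proof -
  define y where "y = larger_root (w - s) d t + s"
  have y: "1 / 2 * (w + s + sqrt ((w - s)\<^sup>2 + 4 * d * t)) = y"
    by (simp add: y_def larger_root_def field_simps)
  have eq: "(y - s) * (y - w) = d * t"
    using larger_root_eq[of d t "w - s"] assms by (simp add: y_def algebra_simps)
  have ge: "w \<le> y"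
    using larger_root_ge[of d t "w - s"] assms by (simp add: y_def)
  show ?thesis
  proof (cases "y \<le> w + d")
    case True
    then have "s * (y - w) \<le> s * d" using assms by (intro mult_left_mono) auto
    then have "y * (y - w) \<le> d * (s + t)" using eq by (simp add: algebra_simps)
    then have "y \<le> larger_root w d (s + t)" by (rule le_larger_rootI)
    then show ?thesis unfolding y by (rule min.coboundedI2)
  next
    case False
    \<comment> \<open>Otherwise both factors of \<open>(y - w) * (y - s)\<close> would be too large
      for the product to equal \<open>d * t\<close>.\<close>
    have "w + d \<le> s + t"
    proof (rule ccontr)
      assume "\<not> w + d \<le> s + t"
      then have "t < y - s" "d < y - w" using False by auto
      then have "d * t < (y - w) * (y - s)"
        using assms by (intro mult_strict_mono') auto
      with eq show False by (simp add: mult.commute)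
    qed
    then have "(w + d) * d \<le> (s + t) * d" using assms by (intro mult_right_mono) auto
    then have "w + d \<le> larger_root w d (s + t)"
      by (intro le_larger_rootI) (simp add: mult.commute)
    then show ?thesis by simp
  qed
qed

section \<open>Comparison of max-min expressions\<close>

lemma UNIV_minus_singleton_nonempty:
  fixes i :: "'n::finite"
  assumes "CARD('n) \<ge> 2"
  shows "UNIV - {i} \<noteq> {}"
proof
  assume "UNIV - {i} = {}"
  then have "CARD('n) \<le> card {i}" by (intro card_mono) auto
  with assms show False by simp
qed

lemma Max_Min_leI:
  fixes f :: "'n::finite \<Rightarrow> 'n \<Rightarrow> real"
  assumes "CARD('n) \<ge> 2"
    and "\<And>i. \<exists>j. j \<noteq> i \<and> f i j \<le> u"
  shows "(MAX i. MIN j\<in>UNIV - {i}. f i j) \<le> u"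
proof -
  have "(MIN j\<in>UNIV - {i}. f i j) \<le> u" for i
  proof -
    obtain j where j: "j \<noteq> i" "f i j \<le> u" using assms(2) by blast
    have "(MIN j\<in>UNIV - {i}. f i j) \<le> f i j" using j by (intro Min_le) auto
    then show ?thesis using j(2) by (rule order_trans)
  qed
  then show ?thesis by auto
qed

text \<open>The minimum over row \<open>k\<close> of \<open>g\<close> is attained at some
  \<open>l\<close> that is not known in advance, so \<open>j\<close> may depend on \<open>l\<close>,
  but \<open>k\<close> may not.\<close>

lemma Max_Min_mono:
  fixes f g :: "'n::finite \<Rightarrow> 'n \<Rightarrow> real"
  assumes card: "CARD('n) \<ge> 2"
    and le: "\<And>i. \<exists>k. \<forall>l. l \<noteq> k \<longrightarrow> (\<exists>j. j \<noteq> i \<and> f i j \<le> g k l)"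
  shows "(MAX i. MIN j\<in>UNIV - {i}. f i j) \<le> (MAX i. MIN j\<in>UNIV - {i}. g i j)"
proof (rule Max_Min_leI [OF card])
  fix i
  obtain k where k: "\<And>l. l \<noteq> k \<Longrightarrow> \<exists>j. j \<noteq> i \<and> f i j \<le> g k l" using le by blast
  have "(MIN l\<in>UNIV - {k}. g k l) \<in> g k ` (UNIV - {k})"
    using UNIV_minus_singleton_nonempty [OF card] by (intro Min_in) auto
  then obtain l where l: "l \<noteq> k" "(MIN l\<in>UNIV - {k}. g k l) = g k l" by blast
  obtain j where j: "j \<noteq> i" "f i j \<le> g k l" using k l by blast
  have "g k l \<le> (MAX k. MIN l\<in>UNIV - {k}. g k l)"
    unfolding l(2) [symmetric] by (intro Max_ge) auto
  with j show "\<exists>j. j \<noteq> i \<and> f i j \<le> (MAX k. MIN l\<in>UNIV - {k}. g k l)"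
    by (meson order_trans)
qed

lemma Max_Min_larger_root_mono:
  fixes R :: "'n::finite \<Rightarrow> real" and a d :: "'n \<Rightarrow> 'n \<Rightarrow> real"
  assumes card: "CARD('n) \<ge> 2"
    and a: "\<And>i j. 0 \<le> a i j" "\<And>i j. a i j \<le> d i j" and d: "\<And>i j. d i j \<le> R i"
  shows "(MAX i. MIN j\<in>UNIV - {i}. larger_root (R i - d i j) (d i j) (R j)) \<le>
    (MAX i. MIN j\<in>UNIV - {i}. larger_root (R i - a i j) (a i j) (R j))"
    (is "(MAX i. MIN j\<in>UNIV - {i}. ?B i j) \<le> (MAX i. MIN j\<in>UNIV - {i}. ?C i j)")
proof (rule Max_Min_mono [OF card])
  fix i
  have d0: "0 \<le> d i j" for i j using a by (meson order_trans)
  have R0: "0 \<le> R i" for i using d0 d by (meson order_trans)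
  have C: "min (R i) (R j) \<le> ?C i j" for i j
    by (intro min_le_larger_root a R0)
  have B: "?B i j \<le> max (R i) (R j)" for i j
    by (intro larger_root_le_max d0 R0)
  show "\<exists>k. \<forall>l. l \<noteq> k \<longrightarrow> (\<exists>j. j \<noteq> i \<and> ?B i j \<le> ?C k l)"
  proof (cases "\<exists>j. j \<noteq> i \<and> R j \<le> R i")
    case True
    then obtain j where j: "j \<noteq> i" "R j \<le> R i" by blast
    have "\<exists>j. j \<noteq> i \<and> ?B i j \<le> ?C i l" if "l \<noteq> i" for l
    proof (cases "R l \<le> R i")
      case True
      then have "?B i l \<le> ?C i l" using a R0 by (intro larger_root_antimono) auto
      with that show ?thesis by blast
    next
      case False
      \<comment> \<open>Both sides are separated by \<open>R i\<close>, which is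
        \<open>max (R i) (R j)\<close> and also \<open>min (R i) (R l)\<close>.\<close>
      then have "?B i j \<le> ?C i l" using B[of i j] C[of i l] j by simp
      with j show ?thesis by blast
    qed
    then show ?thesis by blast
  next
    case False
    then have least: "R i < R j" if "j \<noteq> i" for j using that by force
    obtain k where k: "k \<noteq> i" using UNIV_minus_singleton_nonempty [OF card] by blast
    have "\<exists>j. j \<noteq> i \<and> ?B i j \<le> ?C k l" if "l \<noteq> k" for l
    proof (cases "l = i")
      case True
      have "a k i \<le> R k" using a d by (meson order_trans)
      then have "?B i k \<le> ?C k i" using least[OF k] a d d0 by (intro larger_root_swap) auto
      with True k show ?thesis by blast
    next
      case False
      \<comment> \<open>Of \<open>k\<close> and \<open>l\<close>, both different from
        \<open>i\<close>, take the row with the smaller sum: then \<open>R j\<close> is the lower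
        bound for \<open>?C k l\<close>, and it bounds \<open>?B i j\<close> from above since row
        \<open>i\<close> is least.\<close>
      define j where "j = (if R k \<le> R l then k else l)"
      have j: "j \<noteq> i" "R j = min (R k) (R l)" using k False by (auto simp: j_def)
      have "?B i j \<le> R j" using B[of i j] least[OF j(1)] by simp
      also have "\<dots> \<le> ?C k l" using C[of k l] by (simp only: j(2))
      finally have "?B i j \<le> ?C k l" .
      with j show ?thesis by blast
    qed
    then show ?thesis by blast
  qed
qed

section \<open>Row sums of the tensor and the chain of bounds\<close>

lemma row_sum_split: "row_sum m A i = row_sum_without m A i j + row_sum_with m A i j"
proof -
  have "row_sum m A i = (\<Sum>is\<in>{is \<in> tuples (m - 1). j \<notin> set is} \<union> {is \<in> tuples (m - 1). j \<in> set is}. \<bar>A (i # is)\<bar>)"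
    unfolding row_sum_def by (intro sum.cong) auto
  also have "\<dots> = row_sum_without m A i j + row_sum_with m A i j"
    unfolding row_sum_without_def row_sum_with_def by (intro sum.union_disjoint) auto
  finally show ?thesis .
qed

lemma row_sum_with_nonneg: "0 \<le> row_sum_with m A i j"
  by (simp add: row_sum_with_def sum_nonneg)

lemma row_sum_without_nonneg: "0 \<le> row_sum_without m A i j"
  by (simp add: row_sum_without_def sum_nonneg)

lemma off_entry_nonneg:
  assumes "nonneg_tensor m A" "m \<ge> 1"
  shows "0 \<le> off_entry m A i j"
  using assms by (simp add: nonneg_tensor_def off_entry_def tuples_def)

text \<open>Since \<open>m >= 2\<close>, the constant list of length \<open>m - 1\<close> is
  nonempty and so contains \<open>j\<close>, which makes the entry one of the summands.\<close>

lemma off_entry_le_row_sum_with: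
  assumes "m \<ge> 2"
  shows "off_entry m A i j \<le> row_sum_with m A i j"
proof -
  have "off_entry m A i j \<le> \<bar>A (i # replicate (m - 1) j)\<bar>"
    by (simp add: off_entry_def)
  also have "\<dots> \<le> row_sum_with m A i j"
    unfolding row_sum_with_def using assms
    by (intro member_le_sum [where f = "\<lambda>is. \<bar>A (i # is)\<bar>"]) (auto simp: tuples_def intro: finite_subset [OF _ finite_tuples])
  finally show ?thesis .
qed

lemma Omega_max_le:
  fixes A :: "'n::finite tensor"
  assumes card: "CARD('n) \<ge> 2"
  shows "Omega_max m A \<le> (MAX i. MIN j\<in>UNIV - {i}.
    larger_root (row_sum_without m A i j) (row_sum_with m A i j) (row_sum m A j))"
proof -
  note nonneg = row_sum_with_nonneg row_sum_without_nonneg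
  let ?B = "\<lambda>i j. larger_root (row_sum_without m A i j) (row_sum_with m A i j) (row_sum m A j)"
  \<comment> \<open>The root is at least \<open>p\<close>, so it dominates the first term of the
    minimum in \<open>Omega_hat_max\<close>.\<close>
  have "row_sum_without m A i j \<le> ?B i j" for i j
    by (intro larger_root_ge) (simp add: nonneg row_sum_split [of m A j j])
  then have "min (row_sum_without m A i j) (row_sum_with m A j j) \<le> ?B i j" for i j
    by (simp add: min.coboundedI1)
  then have hat: "Omega_hat_max m A \<le> (MAX i. MIN j\<in>UNIV - {i}. ?B i j)"
    unfolding Omega_hat_max_def by (intro Max_Min_mono [OF card]) blast
  have "min (row_sum m A i) (Omega_bar m A i j) \<le> ?B i j" for i j
    unfolding Omega_bar_def row_sum_split [of m A i j] row_sum_split [of m A j j] add.commute [of "row_sum_without m A j j"]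
    by (intro min_le_larger_root_row_pair nonneg)
  then have "Omega_tilde_max m A \<le> (MAX i. MIN j\<in>UNIV - {i}. ?B i j)"
    unfolding Omega_tilde_max_def by (intro Max_Min_mono [OF card]) blast
  with hat show ?thesis by (simp add: Omega_max_def)
qed

theorem theorem7:
  fixes A :: "'n::finite tensor" and m :: nat
  assumes "CARD('n) \<ge> 2"
    and "m \<ge> 2"
    and "nonneg_tensor m A"
    and "weakly_symmetric m A"
  shows "Omega_max m A \<le>
      (MAX i. MIN j\<in>UNIV - {i}. 1 / 2 * (row_sum_without m A i j
         + sqrt ((row_sum_without m A i j)\<^sup>2 + 4 * row_sum_with m A i j * row_sum m A j)))
    \<and> (MAX i. MIN j\<in>UNIV - {i}. 1 / 2 * (row_sum_without m A i j
         + sqrt ((row_sum_without m A i j)\<^sup>2 + 4 * row_sum_with m A i j * row_sum m A j))) \<le>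
      (MAX i. MIN j\<in>UNIV - {i}. 1 / 2 * (row_sum m A i - off_entry m A i j
         + sqrt ((row_sum m A i - off_entry m A i j)\<^sup>2 + 4 * off_entry m A i j * row_sum m A j)))
    \<and> (MAX i. MIN j\<in>UNIV - {i}. 1 / 2 * (row_sum m A i - off_entry m A i j
         + sqrt ((row_sum m A i - off_entry m A i j)\<^sup>2 + 4 * off_entry m A i j * row_sum m A j))) \<le>
      (MAX i. row_sum m A i)"
proof -
  have a: "0 \<le> off_entry m A i j" "off_entry m A i j \<le> row_sum_with m A i j" for i j
    using assms off_entry_nonneg[of m A] off_entry_le_row_sum_with[of m A] by auto
  have d: "row_sum_with m A i j \<le> row_sum m A i" for i j
    using row_sum_without_nonneg[of m A i j] by (simp add: row_sum_split [of m A i j])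
  \<comment> \<open>This gives the second bound the shape \<open>R - d\<close> that it shares with
    the third, where \<open>off_entry\<close> takes the place of \<open>d\<close>.\<close>
  have w: "row_sum_without m A i j = row_sum m A i - row_sum_with m A i j" for i j
    by (simp add: row_sum_split [of m A i j])
  let ?C = "\<lambda>i j. larger_root (row_sum m A i - off_entry m A i j) (off_entry m A i j) (row_sum m A j)"
  have second: "(MAX i. MIN j\<in>UNIV - {i}.
      larger_root (row_sum_without m A i j) (row_sum_with m A i j) (row_sum m A j)) \<le>
    (MAX i. MIN j\<in>UNIV - {i}. ?C i j)"
    unfolding w by (intro Max_Min_larger_root_mono assms(1) a d)
  have "(MAX i. MIN j\<in>UNIV - {i}. ?C i j) \<le> (MAX i. row_sum m A i)"
  proof (rule Max_Min_leI [OF assms(1)])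
    fix i :: 'n
    obtain j where j: "j \<noteq> i" using UNIV_minus_singleton_nonempty [OF assms(1)] by blast
    have "0 \<le> row_sum m A i" using a d by (meson order_trans)
    then have "?C i j \<le> max (row_sum m A i) (row_sum m A j)"
      by (intro larger_root_le_max a)
    also have "\<dots> \<le> (MAX i. row_sum m A i)" by simp
    finally show "\<exists>j. j \<noteq> i \<and> ?C i j \<le> (MAX i. row_sum m A i)" using j by blast
  qed
  with Omega_max_le [OF assms(1), of m A] second show ?thesis
    unfolding larger_root_def by blast
qed

end
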